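(* Let $n\ge 2$ be an integer and let $\zeta$ be a primitive $n$th root of unity. Then \[ \sum_{\substack{1\le k\le n\\ (n,k)=1}}\frac{\zeta^k}{(1-\zeta^k)^2}=-\frac{J_2(n)}{12}, \] where $J_2(n)=\sum_{d\mid n}\mu(n/d)\,d^2$ is the Jordan totient function of order $2$ and $\mu$ is the Möbius function.
   Context: $(n,k)$ denotes the greatest common divisor of $n$ and $k$. The Jordan totient function $J_2(n)$ is the number of pairs $(a,b)$ of positive integers with $a,b\le n$ such that $\gcd(a,b,n)=1$; equivalently $J_2(n)=\sum_{d\mid n}\mu(n/d)d^2$. *)

theory Defs
  imports Complex_Main "HOL-Computational_Algebra.Computational_Algebra"
begin

definition moebius_mu :: "nat \<Rightarrow> int" where
  "moebius_mu n = (if squarefree n then (-1) ^ card (prime_factors n) else 0)"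

definition jordan_totient_2 :: "nat \<Rightarrow> int" where
  "jordan_totient_2 n = (\<Sum>d | d dvd n. moebius_mu (n div d) * int d ^ 2)"

definition primitive_root_of_unity :: "nat \<Rightarrow> complex \<Rightarrow> bool" where
  "primitive_root_of_unity n z \<longleftrightarrow> n > 0 \<and> z ^ n = 1 \<and> (\<forall>m. 0 < m \<and> m < n \<longrightarrow> z ^ m \<noteq> 1)"

end

(* Summing x / (1 - x)^2 over the n-th roots of unity x \<noteq> 1 is easy once the summand is written as the
   finite Fourier sum 1/(2n) * (\<Sum>j<n. j (n - j) x^j): over all n-th roots of unity the Fourier sums
   cancel, so the sum over x \<noteq> 1 is minus the value of the Fourier sum at x = 1, i.e. - (n^2 - 1) / 12.  The coprimality
   condition is expanded by the Moebius function. *)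
theory Submission
  imports Defs
begin

text \<open>Multiplication by \<open>(1 - x)^2\<close> takes second differences of the coefficients.
  For \<open>j * (c - j)\<close> these are constantly -2, which leaves a geometric sum and boundary
  terms. Keeping \<open>c\<close> independent of \<open>m\<close> lets the induction on
  \<open>m\<close> go through.\<close>

lemma second_difference_sum:
  fixes x c :: "'a :: comm_ring_1"
  shows "(1 - x)^2 * (\<Sum>j<m. of_nat j * (c - of_nat j) * x ^ j) =
           2 + (c + 1) * x - 2 * (\<Sum>j<m. x ^ j) - (2 + of_nat m * (c - of_nat m)) * x ^ m
           + (of_nat m - 1) * (c + 1 - of_nat m) * x ^ Suc m"
proof (induction m)
  case 0
  show ?case by (simp add: algebra_simps)
next
  case (Suc m)
  show ?case
    unfolding sum.lessThan_Suc distrib_left Suc.IH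
    by (simp add: algebra_simps power2_eq_square)
qed

lemma sum_powers_root_of_unity:
  fixes x :: "'a :: field"
  assumes "x ^ n = 1" "x \<noteq> 1"
  shows "(\<Sum>j<n. x ^ j) = 0"
  using assms by (simp add: geometric_sum)

lemma root_of_unity_fourier:
  fixes x :: "'a :: field_char_0"
  assumes "x ^ n = 1" "x \<noteq> 1" "n > 0"
  shows "x / (1 - x)^2 = (\<Sum>j<n. of_nat j * (of_nat n - of_nat j) * x ^ j) / (2 * of_nat n)"
proof -
  have "(1 - x)^2 * (\<Sum>j<n. of_nat j * (of_nat n - of_nat j) * x ^ j) = 2 * of_nat n * x"
    \<comment> \<open>With \<open>c = m = n\<close> and \<open>x ^ n = 1\<close> the geometric sum
      vanishes, the constants 2 and -2 cancel, and \<open>(n + 1) * x + (n - 1) * x\<close>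
      remains.\<close>
    unfolding second_difference_sum
    using assms by (simp add: sum_powers_root_of_unity algebra_simps)
  then show ?thesis
    using assms by (simp add: field_simps)
qed

text \<open>Gives the Fourier sum at \<open>x = 1\<close>: for \<open>c = m = n\<close> the last
  factor becomes \<open>n + 1\<close>. Again \<open>c\<close> stays free for the induction.\<close>

lemma sum_times_reflected:
  fixes c :: "'a :: comm_ring_1"
  shows "6 * (\<Sum>j<m. of_nat j * (c - of_nat j)) =
           of_nat m * (of_nat m - 1) * (3 * c + 1 - 2 * of_nat m)"
  by (induction m) (simp_all add: algebra_simps)

lemma primitive_root_power_eq_1_iff:
  assumes "primitive_root_of_unity n w"
  shows "w ^ j = 1 \<longleftrightarrow> n dvd j"
proof -
  have "w ^ j = w ^ (n * (j div n) + j mod n)" by simp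
  also have "\<dots> = w ^ (j mod n)"
    using assms by (simp only: power_add power_mult primitive_root_of_unity_def) simp
  finally have "w ^ j = w ^ (j mod n)" .
  moreover have "j mod n < n"
    using assms by (simp add: primitive_root_of_unity_def)
  ultimately show ?thesis
    using assms by (metis primitive_root_of_unity_def mod_eq_0_iff_dvd gr0I power_0)
qed

text \<open>Moebius expansion leaves sums over the multiples of \<open>d\<close>, that is, over
  powers of \<open>w ^ d\<close>; this supplies the order of that root.\<close>

lemma primitive_root_power:
  assumes "primitive_root_of_unity n w" "d dvd n"
  shows "primitive_root_of_unity (n div d) (w ^ d)"
proof -
  obtain m where m: "n = d * m" using assms(2) by blast
  have "d > 0" "m > 0"
    using assms(1) m by (simp_all add: primitive_root_of_unity_def)
  then show ?thesis
    using primitive_root_power_eq_1_iff[OF assms(1)] m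
    unfolding primitive_root_of_unity_def
    by (auto simp flip: power_mult dest: dvd_imp_le)
qed

text \<open>The summand at \<open>k = n\<close> is \<open>1 / 0 = 0\<close>.\<close>

lemma sum_all_roots_of_unity:
  assumes "primitive_root_of_unity n w"
  shows "(\<Sum>k=1..n. w ^ k / (1 - w ^ k)^2) = - (of_nat n ^ 2 - 1) / 12"
proof -
  have n: "n > 0" and wn: "w ^ n = 1"
    using assms by (simp_all add: primitive_root_of_unity_def)
  define c :: "nat \<Rightarrow> complex" where "c j = of_nat j * (of_nat n - of_nat j)" for j
  define F where "F x = (\<Sum>j<n. c j * x ^ j) / (2 * of_nat n)" for x
  have *: "w ^ k / (1 - w ^ k)^2 = F (w ^ k)" if "k \<in> {1..<n}" for k
    unfolding F_def c_def
  proof (rule root_of_unity_fourier)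
    show "(w ^ k) ^ n = 1" by (metis wn power_mult mult.commute power_one)
    show "w ^ k \<noteq> 1"
      using that primitive_root_power_eq_1_iff[OF assms] by (auto dest: dvd_imp_le)
  qed (use n in auto)
  \<comment> \<open>Orthogonality: for \<open>0 < j < n\<close> the inner sum runs over the powers
    of \<open>w ^ j \<noteq> 1\<close> and vanishes; for \<open>j = 0\<close> it equals
    \<open>n\<close>, but \<open>c 0 = 0\<close>.\<close>
  have "(\<Sum>k<n. \<Sum>j<n. c j * (w ^ k) ^ j) = (\<Sum>j<n. c j * (\<Sum>k<n. (w ^ j) ^ k))"
    by (subst sum.swap) (simp add: sum_distrib_left mult.commute flip: power_mult)
  also have "\<dots> = 0"
  proof (intro sum.neutral ballI)
    fix j assume "j \<in> {..<n}"
    show "c j * (\<Sum>k<n. (w ^ j) ^ k) = 0"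
    proof (cases "j = 0")
      case False
      then have "w ^ j \<noteq> 1"
        using \<open>j \<in> {..<n}\<close> primitive_root_power_eq_1_iff[OF assms] by (auto dest: dvd_imp_le)
      moreover have "(w ^ j) ^ n = 1" by (metis wn power_mult mult.commute power_one)
      ultimately show ?thesis by (simp add: sum_powers_root_of_unity)
    qed (simp add: c_def)
  qed
  finally have total: "(\<Sum>k<n. F (w ^ k)) = 0"
    by (simp add: F_def flip: sum_divide_distrib)
  \<comment> \<open>The root 1 occurs at \<open>k = n\<close> in the first range, where the quotient
    is 0, and at \<open>k = 0\<close> in the second, where the Fourier sum contributes
    \<open>F 1\<close>.\<close>
  have "{1..n} = insert n {1..<n}" "{..<n} = insert 0 {1..<n}" using n by auto
  then have "(\<Sum>k=1..n. w ^ k / (1 - w ^ k)^2) = (\<Sum>k\<in>{1..<n}. F (w ^ k))"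
    and "(\<Sum>k<n. F (w ^ k)) = F 1 + (\<Sum>k\<in>{1..<n}. F (w ^ k))"
    using * wn by simp_all
  then have "(\<Sum>k=1..n. w ^ k / (1 - w ^ k)^2) = - F 1"
    using total by (simp add: eq_neg_iff_add_eq_0 add.commute)
  moreover have "6 * (\<Sum>j<n. c j) = of_nat n * (of_nat n ^ 2 - 1)"
    unfolding c_def sum_times_reflected by (simp add: algebra_simps power2_eq_square)
  then have "(\<Sum>j<n. c j) = of_nat n * (of_nat n ^ 2 - 1) / 6"
    by (simp add: field_simps)
  ultimately show ?thesis
    using n by (simp add: F_def diff_divide_distrib)
qed

text \<open>A prime coprime to \<open>d\<close> preserves squarefreeness or its failure and adds
  exactly one prime factor. This sign change drives the cancellation over divisors.\<close>

lemma moebius_mu_prime_mult: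
  assumes "prime p" "\<not> p dvd d" "d > 0"
  shows "moebius_mu (p * d) = - moebius_mu d"
proof -
  have "coprime p d" using assms by (simp add: prime_imp_coprime)
  then have "squarefree (p * d) \<longleftrightarrow> squarefree d"
    using squarefree_mult_coprime[of p d] squarefree_prime[OF assms(1)] squarefree_multD(2)[of p d]
    by blast
  moreover have "prime_factors (p * d) = insert p (prime_factors d)"
    using assms by (simp add: prime_factors_product prime_prime_factors prime_gt_0_nat)
  moreover have "p \<notin> prime_factors d" using assms by auto
  ultimately show ?thesis by (simp add: moebius_mu_def)
qed

text \<open>For \<open>m \<noteq> 1\<close> fix a prime \<open>p\<close> dividing \<open>m\<close>.
  The squarefree divisors fall into pairs \<open>d\<close>, \<open>p * d\<close> with
  \<open>d\<close> not divisible by \<open>p\<close>, and the two values in each pair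
  cancel.\<close>

lemma sum_moebius_mu_divisors:
  assumes "m > 0"
  shows "(\<Sum>d | d dvd m. moebius_mu d) = (if m = 1 then 1 else 0)"
proof (cases "m = 1")
  case False
  then obtain p where p: "prime p" "p dvd m" by (metis prime_factor_nat)
  define A where "A = {d. d dvd m \<and> \<not> p dvd d \<and> squarefree d}"
  have fin: "finite {d. d dvd m}" using assms by simp
  then have finA: "finite A" by (rule rev_finite_subset) (auto simp: A_def)
  have p0: "p > 0" using p prime_gt_0_nat by blast
  have pos: "d > 0" if "d \<in> A" for d using that assms by (auto simp: A_def intro: Nat.gr0I)
  have sqf: "{d. d dvd m \<and> squarefree d} = A \<union> (*) p ` A"
  proof (intro equalityI subsetI)
    fix d assume d: "d \<in> {d. d dvd m \<and> squarefree d}"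
    show "d \<in> A \<union> (*) p ` A"
    proof (cases "p dvd d")
      case True
      then obtain e where e: "d = p * e" by blast
      have "\<not> p dvd e"
      proof
        assume "p dvd e"
        then have "p ^ 2 dvd d" by (simp add: e power2_eq_square)
        then have "p dvd 1" using d unfolding squarefree_def by blast
        then show False using p(1) by auto
      qed
      then have "e \<in> A"
        using d by (auto simp: A_def e dest: dvd_mult_right squarefree_multD)
      then show ?thesis using e by blast
    qed (use d in \<open>simp add: A_def\<close>)
  next
    fix d assume "d \<in> A \<union> (*) p ` A"
    then show "d \<in> {d. d dvd m \<and> squarefree d}"
      using p by (auto simp: A_def prime_imp_coprime squarefree_mult_coprime squarefree_prime
                       intro: divides_mult)
  qed
  have "(\<Sum>d | d dvd m. moebius_mu d) = (\<Sum>d | d dvd m \<and> squarefree d. moebius_mu d)"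
    using fin by (intro sum.mono_neutral_right) (auto simp: moebius_mu_def)
  also have "\<dots> = (\<Sum>d\<in>A. moebius_mu d) + (\<Sum>d\<in>(*) p ` A. moebius_mu d)"
    unfolding sqf using finA by (intro sum.union_disjoint) (auto simp: A_def)
  also have "(\<Sum>d\<in>(*) p ` A. moebius_mu d) = (\<Sum>d\<in>A. moebius_mu (p * d))"
    using p0 by (subst sum.reindex) (auto simp: inj_on_def)
  also have "\<dots> = (\<Sum>d\<in>A. - moebius_mu d)"
    using p pos by (intro sum.cong) (auto simp: A_def moebius_mu_prime_mult)
  finally show ?thesis using False by (simp add: sum_negf)
qed (simp add: moebius_mu_def)

text \<open>The indicator of \<open>gcd n k = 1\<close> is the sum of \<open>moebius_mu d\<close>
  over the common divisors \<open>d\<close> of \<open>n\<close> and \<open>k\<close>. Exchanging the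
  sums and writing \<open>k = d * j\<close> gives the right-hand side.\<close>

lemma sum_coprime_moebius_mu:
  fixes f :: "nat \<Rightarrow> 'a :: comm_ring_1"
  assumes "n > 0"
  shows "(\<Sum>k | 1 \<le> k \<and> k \<le> n \<and> gcd n k = 1. f k) =
           (\<Sum>d | d dvd n. of_int (moebius_mu d) * (\<Sum>j=1..n div d. f (d * j)))"
proof -
  have fin: "finite {d. d dvd n}" using assms by simp
  have multiples: "{k \<in> {1..n}. d dvd k} = (*) d ` {1..n div d}" if "d dvd n" for d
  proof -
    have "d > 0" using that assms by (auto intro: Nat.gr0I)
    then show ?thesis
      by (auto simp: less_eq_div_iff_mult_less_eq mult.commute elim!: dvdE)
  qed
  have "{k. 1 \<le> k \<and> k \<le> n \<and> gcd n k = 1} = {k \<in> {1..n}. gcd n k = 1}" by auto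
  then have "(\<Sum>k | 1 \<le> k \<and> k \<le> n \<and> gcd n k = 1. f k) =
               (\<Sum>k=1..n. if gcd n k = 1 then f k else 0)"
    by (simp only: sum.inter_filter finite_atLeastAtMost)
  also have "\<dots> = (\<Sum>k=1..n. of_int (\<Sum>d | d dvd gcd n k. moebius_mu d) * f k)"
  proof (intro sum.cong refl)
    fix k
    have "gcd n k > 0" using assms by simp
    then show "(if gcd n k = 1 then f k else 0) =
                 of_int (\<Sum>d | d dvd gcd n k. moebius_mu d) * f k"
      by (subst sum_moebius_mu_divisors) simp_all
  qed
  also have "\<dots> = (\<Sum>k=1..n. \<Sum>d | d dvd n \<and> d dvd k. of_int (moebius_mu d) * f k)"
    by (simp add: sum_distrib_right)
  also have "\<dots> = (\<Sum>d | d dvd n. \<Sum>k | k \<in> {1..n} \<and> d dvd k. of_int (moebius_mu d) * f k)"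
    using sum.swap_restrict[OF finite_atLeastAtMost fin,
        of "\<lambda>k d. of_int (moebius_mu d) * f k" "\<lambda>k d. d dvd k" 1 n] by simp
  also have "\<dots> = (\<Sum>d | d dvd n. of_int (moebius_mu d) * (\<Sum>j=1..n div d. f (d * j)))"
  proof (intro sum.cong refl)
    fix d assume "d \<in> {d. d dvd n}"
    then have d: "d dvd n" "d > 0" using assms by (auto intro: Nat.gr0I)
    show "(\<Sum>k | k \<in> {1..n} \<and> d dvd k. of_int (moebius_mu d) * f k) =
            of_int (moebius_mu d) * (\<Sum>j=1..n div d. f (d * j))"
      unfolding multiples[OF d(1)]
      using d by (subst sum.reindex) (auto simp: inj_on_def sum_distrib_left)
  qed
  finally show ?thesis .
qed

text \<open>The involution sending \<open>d\<close> to \<open>n div d\<close> on the divisors of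
  \<open>n\<close> brings the definition into the form that Moebius expansion produces.\<close>

lemma jordan_totient_2_alt:
  assumes "n > 0"
  shows "jordan_totient_2 n = (\<Sum>d | d dvd n. moebius_mu d * int (n div d) ^ 2)"
  unfolding jordan_totient_2_def using assms
  by (intro sum.reindex_bij_witness[of _ "\<lambda>d. n div d" "\<lambda>d. n div d"])
     (auto simp: div_dvd_iff_mult dvd_div_eq_mult elim!: dvdE)

theorem theorem1p1:
  fixes n :: nat and \<zeta> :: complex
  assumes "n \<ge> 2" and "primitive_root_of_unity n \<zeta>"
  shows "(\<Sum>k | 1 \<le> k \<and> k \<le> n \<and> gcd n k = 1. \<zeta> ^ k / (1 - \<zeta> ^ k) ^ 2)
           = - of_int (jordan_totient_2 n) / 12"
proof -
  have n: "n > 0" using assms(1) by simp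
  let ?\<mu> = "\<lambda>d. of_int (moebius_mu d) :: complex"
  have "(\<Sum>k | 1 \<le> k \<and> k \<le> n \<and> gcd n k = 1. \<zeta> ^ k / (1 - \<zeta> ^ k) ^ 2) =
          (\<Sum>d | d dvd n. ?\<mu> d * (\<Sum>j=1..n div d. (\<zeta> ^ d) ^ j / (1 - (\<zeta> ^ d) ^ j) ^ 2))"
    unfolding sum_coprime_moebius_mu[OF n] by (simp only: power_mult)
  \<comment> \<open>Here \<zeta>\<open>^ d\<close> has order \<open>n div d\<close>. The case
    \<open>d = n\<close> is covered too: the order is 1 and both inner expressions are 0.\<close>
  also have "\<dots> = (\<Sum>d | d dvd n. ?\<mu> d * (- (of_nat (n div d) ^ 2 - 1) / 12))"
    by (intro sum.cong refl)
       (simp only: mem_Collect_eq sum_all_roots_of_unity[OF primitive_root_power[OF assms(2)]])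
  also have "\<dots> = (of_int (\<Sum>d | d dvd n. moebius_mu d) - of_int (jordan_totient_2 n)) / 12"
    unfolding jordan_totient_2_alt[OF n]
    by (simp add: sum_subtractf[symmetric] sum_divide_distrib algebra_simps diff_divide_distrib)
  \<comment> \<open>The constant 1 in each \<open>1 - (n div d)^2\<close> has collected into the
    divisor sum of \<open>moebius_mu\<close>, which is 0 because \<open>n \<ge> 2\<close>.\<close>
  finally show ?thesis
    using assms(1) by (simp add: sum_moebius_mu_divisors)
qed

end
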